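(* Let $n\ge1$ be an integer, let $C=\operatorname{circ}(c_1,\dots,c_n)$ be a complex circulant matrix, let $\Delta$ be the comultiplication of the Hopf algebra $C^n_{\mathbb{C}}$ of complex circulant $n\times n$ matrices, and let $P_n=\operatorname{circ}(0,1,0,\dots,0)$. Then $\Delta(C)$, regarded as an $n^2\times n^2$ matrix, is the block circulant matrix with circulant blocks $\operatorname{circ}(c_1I_n,c_2P_n,\dots,c_nP_n^{n-1})$. Moreover, the eigenvalues of $\Delta(C)$ are the eigenvalues of $C$, each one with multiplicity $n$ (that is, if $\lambda_1,\dots,\lambda_n$ are the eigenvalues of $C$ listed with multiplicity, then the list of eigenvalues of $\Delta(C)$ with multiplicity consists of $\lambda_1,\dots,\lambda_n$, each repeated $n$ times).
   Context: $\operatorname{circ}(c_1,\dots,c_n)$ is the $n\times n$ matrix with $(i,j)$ entry $c_{j-i+1}$ (subscripts mod $n$); likewise, for $n\times n$ matrices $A_1,\dots,A_n$, $\operatorname{circ}(A_1,\dots,A_n)$ is the $n^2\times n^2$ block matrix whose $(i,j)$ block is $A_{j-i+1}$. $\mathbb{Z}_n$ is the cyclic group of order $n$ with elements $e_1,\dots,e_n$, $e_i$ being the class of $i-1$. The algebra $C^n_{\mathbb{C}}$ of complex circulant matrices carries the Hopf algebra structure transferred from the group Hopf algebra $\mathbb{C}\mathbb{Z}_n$ (where $\Delta(e_i)=e_i\otimes e_i$) via the algebra isomorphism $g:\mathbb{C}\mathbb{Z}_n\to C^n_{\mathbb{C}}$, $g(c_1e_1+\dots+c_ne_n)=\operatorname{circ}(c_1,\dots,c_n)$;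 so $\Delta=(g\otimes g)\circ\Delta_{\mathbb{C}\mathbb{Z}_n}\circ g^{-1}$. Elements of $C^n_{\mathbb{C}}\otimes C^n_{\mathbb{C}}$ are regarded as $n^2\times n^2$ matrices via the Kronecker product: $A\otimes B$ is the block matrix with $(i,j)$ block $a_{ij}B$. *)

theory Defs
  imports
    "Jordan_Normal_Form.Char_Poly"
    "HOL-Computational_Algebra.Fundamental_Theorem_Algebra"
begin

text \<open>
  All indices are 0-based: position \<open>i < n\<close> of a vector stands for the index \<open>i + 1\<close>, and the
  basis element \<open>e\<^bsub>i+1\<^esub>\<close> of \<open>\<complex>\<int>\<^sub>n\<close> (the class of \<open>i\<close>) is \<open>unit_vec n i\<close>. Adding \<open>n\<close> before
  subtracting keeps \<open>(j - i) mod n\<close> correct on natural numbers.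
\<close>

definition circ :: "complex vec \<Rightarrow> complex mat" where
  "circ c = mat (dim_vec c) (dim_vec c) (\<lambda>(i, j). c $ ((j + dim_vec c - i) mod dim_vec c))"

definition circulants :: "nat \<Rightarrow> complex mat set" where
  "circulants n = circ ` carrier_vec n"

definition block_circ :: "nat \<Rightarrow> (nat \<Rightarrow> complex mat) \<Rightarrow> complex mat" where
  "block_circ n A = mat (n * n) (n * n)
     (\<lambda>(r, s). A ((s div n + n - r div n) mod n) $$ (r mod n, s mod n))"

definition kronecker :: "complex mat \<Rightarrow> complex mat \<Rightarrow> complex mat" where
  "kronecker A B = mat (dim_row A * dim_row B) (dim_col A * dim_col B)
     (\<lambda>(r, s). A $$ (r div dim_row B, s div dim_col B) * B $$ (r mod dim_row B, s mod dim_col B))"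

text \<open>
  An element of \<open>\<complex>\<int>\<^sub>n \<otimes> \<complex>\<int>\<^sub>n\<close> is given by its \<open>n \<times> n\<close> array of coordinates with respect to the
  basis \<open>e\<^sub>p \<otimes> e\<^sub>q\<close>. These arrays are not to be confused with the Kronecker products, which
  represent elements of the tensor square of the algebra of circulant matrices.
\<close>

definition tensor_vec :: "complex vec \<Rightarrow> complex vec \<Rightarrow> complex mat" where
  "tensor_vec v w = mat (dim_vec v) (dim_vec w) (\<lambda>(p, q). v $ p * w $ q)"

text \<open>The linear extension of \<open>e\<^sub>i \<mapsto> e\<^sub>i \<otimes> e\<^sub>i\<close>.\<close>

definition group_comult :: "nat \<Rightarrow> complex vec \<Rightarrow> complex mat" where
  "group_comult n c = mat n n
     (\<lambda>pq. \<Sum>i<n. c $ i * tensor_vec (unit_vec n i) (unit_vec n i) $$ pq)"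

text \<open>
  The map \<open>g \<otimes> g\<close> for \<open>g = circ\<close>, followed by the Kronecker identification: the linear extension of
  \<open>e\<^sub>i \<otimes> e\<^sub>j \<mapsto> kronecker (g e\<^sub>i) (g e\<^sub>j)\<close>.
\<close>

definition circ_tensor_circ :: "nat \<Rightarrow> complex mat \<Rightarrow> complex mat" where
  "circ_tensor_circ n T = mat (n * n) (n * n)
     (\<lambda>rs. \<Sum>i<n. \<Sum>j<n. T $$ (i, j) * kronecker (circ (unit_vec n i)) (circ (unit_vec n j)) $$ rs)"

definition circulant_comult :: "nat \<Rightarrow> complex mat \<Rightarrow> complex mat" where
  "circulant_comult n C =
     circ_tensor_circ n (group_comult n (inv_into (carrier_vec n) circ C))"

text \<open>For \<open>n = 1\<close> the index \<open>1 mod n\<close> is \<open>0\<close>, as \<open>e\<^sub>2 = e\<^sub>1\<close> in \<open>\<int>\<^sub>1\<close>.\<close>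

definition shift_mat :: "nat \<Rightarrow> complex mat" where
  "shift_mat n = circ (unit_vec n (1 mod n))"

text \<open>Eigenvalues with algebraic multiplicity.\<close>

definition eigenvalue_mset :: "complex mat \<Rightarrow> complex multiset" where
  "eigenvalue_mset A = proots (char_poly A)"


lemma circ_inj_on: "inj_on circ (carrier_vec n)"
proof (rule inj_onI)
  fix v w :: "complex vec"
  assume v: "v \<in> carrier_vec n" and w: "w \<in> carrier_vec n" and eq: "circ v = circ w"
  show "v = w"
  proof (rule eq_vecI)
    fix j assume "j < dim_vec w"
    hence j: "j < n" using w by simp
    have "circ v $$ (0, j) = v $ j" "circ w $$ (0, j) = w $ j"
      using v w j by (auto simp: circ_def)
    thus "v $ j = w $ j" using eq by simp
  qed (use v w in auto)
qed

lemma bij_betw_circ: "bij_betw circ (carrier_vec n) (circulants n)"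
  by (simp add: bij_betw_def circ_inj_on circulants_def)

lemma group_comult_unit:
  assumes "i < n"
  shows "group_comult n (unit_vec n i) = tensor_vec (unit_vec n i) (unit_vec n i)"
proof (rule eq_matI)
  fix p q
  let ?T = "\<lambda>j. tensor_vec (unit_vec n j) (unit_vec n j) $$ (p, q)"
  assume "p < dim_row (tensor_vec (unit_vec n i) (unit_vec n i))"
    "q < dim_col (tensor_vec (unit_vec n i) (unit_vec n i))"
  hence "group_comult n (unit_vec n i) $$ (p, q) = (\<Sum>j<n. unit_vec n i $ j * ?T j)"
    by (simp add: group_comult_def tensor_vec_def)
  also have "\<dots> = (\<Sum>j<n. if j = i then ?T j else 0)"
    using assms by (intro sum.cong) (auto simp: unit_vec_def)
  also have "\<dots> = ?T i" using assms by (simp add: sum.delta)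
  finally show "group_comult n (unit_vec n i) $$ (p, q) = ?T i" .
qed (simp_all add: group_comult_def tensor_vec_def)

lemma circ_entry_sum:
  assumes v: "v \<in> carrier_vec n" and a: "a < n" and b: "b < n"
  shows "circ v $$ (a, b) = (\<Sum>i<n. v $ i * circ (unit_vec n i) $$ (a, b))"
proof -
  let ?k = "(b + n - a) mod n"
  have k: "?k < n" using a by simp
  have "(\<Sum>i<n. v $ i * circ (unit_vec n i) $$ (a, b)) = (\<Sum>i<n. if i = ?k then v $ i else 0)"
    using a b k by (intro sum.cong) (auto simp: circ_def unit_vec_def)
  also have "\<dots> = v $ ?k" using k by (simp add: sum.delta)
  finally show ?thesis using v a b by (auto simp: circ_def)
qed

lemma circ_tensor_circ_tensor_vec:
  assumes v: "v \<in> carrier_vec n" and w: "w \<in> carrier_vec n"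
  shows "circ_tensor_circ n (tensor_vec v w) = kronecker (circ v) (circ w)"
proof (rule eq_matI)
  have dims: "dim_row (circ x) = n" "dim_col (circ x) = n" if "x \<in> carrier_vec n" for x
    using that by (auto simp: circ_def)
  show "dim_row (circ_tensor_circ n (tensor_vec v w)) = dim_row (kronecker (circ v) (circ w))"
    "dim_col (circ_tensor_circ n (tensor_vec v w)) = dim_col (kronecker (circ v) (circ w))"
    using v w by (simp_all add: circ_tensor_circ_def kronecker_def dims)
  fix r s
  assume "r < dim_row (kronecker (circ v) (circ w))" "s < dim_col (kronecker (circ v) (circ w))"
  hence r: "r < n * n" and s: "s < n * n" using v w by (simp_all add: kronecker_def dims)
  hence n: "n > 0" by (cases n) auto
  have rs: "r div n < n" "s div n < n" "r mod n < n" "s mod n < n"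
    using r s n by (auto simp: less_mult_imp_div_less)
  have "circ_tensor_circ n (tensor_vec v w) $$ (r, s) =
      (\<Sum>i<n. \<Sum>j<n. (v $ i * circ (unit_vec n i) $$ (r div n, s div n)) *
        (w $ j * circ (unit_vec n j) $$ (r mod n, s mod n)))"
    using r s v w by (simp add: circ_tensor_circ_def tensor_vec_def kronecker_def dims mult_ac)
  also have "\<dots> = circ v $$ (r div n, s div n) * circ w $$ (r mod n, s mod n)"
    by (simp only: sum_product circ_entry_sum[OF v rs(1,2)] circ_entry_sum[OF w rs(3,4)])
  also have "\<dots> = kronecker (circ v) (circ w) $$ (r, s)"
    using r s v w by (simp add: kronecker_def dims)
  finally show "circ_tensor_circ n (tensor_vec v w) $$ (r, s) = kronecker (circ v) (circ w) $$ (r, s)" .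
qed

lemma circulant_comult_circ_unit:
  assumes "i < n"
  shows "circulant_comult n (circ (unit_vec n i)) =
    kronecker (circ (unit_vec n i)) (circ (unit_vec n i))"
  using assms
  by (simp add: circulant_comult_def inv_into_f_f[OF circ_inj_on] group_comult_unit
      circ_tensor_circ_tensor_vec)

lemma set_eigenvalue_mset:
  assumes A: "A \<in> carrier_mat n n"
  shows "set_mset (eigenvalue_mset A) = {k. eigenvalue A k}"
proof -
  have "char_poly A \<noteq> 0" using degree_monic_char_poly[OF A] by auto
  thus ?thesis by (simp add: eigenvalue_mset_def eigenvalue_root_char_poly[OF A])
qed

lemma size_eigenvalue_mset:
  assumes "A \<in> carrier_mat n n"
  shows "size (eigenvalue_mset A) = n"
  using degree_monic_char_poly[OF assms] by (simp add: eigenvalue_mset_def size_proots_complex)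

end

theory Submission
  imports Defs "HOL-Number_Theory.Cong"
begin

text \<open>
  Count all indices from \<open>0\<close>. Since \<open>C = \<Sum>\<^sub>i c\<^sub>i P\<^sup>i\<close> for the shift matrix \<open>P\<close>, and \<open>P\<^sup>i\<close> is the
  image of the class of \<open>i\<close>, which is grouplike, the comultiplication gives \<open>\<Delta>(C) = \<Sum>\<^sub>i c\<^sub>i (P\<^sup>i \<otimes> P\<^sup>i)\<close>. The block of \<open>P\<^sup>i \<otimes> P\<^sup>i\<close> at
  position \<open>(a, a')\<close> is \<open>P\<^sup>i\<close> if \<open>a' - a \<equiv> i\<close> modulo \<open>n\<close>, and zero otherwise. So exactly one
  summand contributes to each block, which is the asserted block circulant form
  (\<open>circulant_comult_eq_block_circ\<close>).

  For the eigenvalues, write a row or column index as a pair \<open>(a, b)\<close> of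
  residues modulo \<open>n\<close>. The entry of \<open>\<Delta>(C)\<close> at \<open>((a, b), (a', b'))\<close> is \<open>C\<^sub>a\<^sub>,\<^sub>a\<^sub>'\<close> if
  \<open>b - a \<equiv> b' - a'\<close>, and zero otherwise. In the coordinates \<open>(d, a)\<close> with \<open>d = b - a\<close> this is the
  block diagonal matrix with \<open>n\<close> copies of \<open>C\<close>, that is, \<open>I\<^sub>n \<otimes> C\<close>
  (\<open>circulant_comult_reindexed\<close>). A simultaneous permutation of rows and columns preserves the
  characteristic polynomial, so the characteristic polynomial of \<open>\<Delta>(C)\<close> is the \<open>n\<close>-th power of
  that of \<open>C\<close>, and every root multiplicity is multiplied by \<open>n\<close>.
\<close>

section \<open>Powers of the cyclic shift\<close>

lemma dim_circ [simp]: "dim_row (circ v) = dim_vec v" "dim_col (circ v) = dim_vec v"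
  by (simp_all add: circ_def)

lemma cyclic_difference_eq_iff:
  fixes a b i n :: nat
  assumes "a < n" "b < n" "i < n"
  shows "(b + n - a) mod n = i \<longleftrightarrow> b = (a + i) mod n"
proof
  assume "(b + n - a) mod n = i"
  hence "(a + i) mod n = (a + (b + n - a)) mod n" by (metis mod_add_right_eq)
  also have "\<dots> = b" using assms by simp
  finally show "b = (a + i) mod n" by simp
next
  assume b: "b = (a + i) mod n"
  have "(b + n - a) mod n = (b + (n - a)) mod n" using assms by simp
  also have "\<dots> = (a + i + (n - a)) mod n" unfolding b by (rule mod_add_left_eq)
  also have "a + i + (n - a) = i + n" using assms by simp
  also have "(i + n) mod n = i" using assms by simp
  finally show "(b + n - a) mod n = i" .
qed

lemma circ_unit_vec_index:
  assumes "a < n" "b < n" "i < n"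
  shows "circ (unit_vec n i) $$ (a, b) = of_bool (b = (a + i) mod n)"
proof -
  have "(b + n - a) mod n < n" using assms by simp
  thus ?thesis using assms by (auto simp: circ_def unit_vec_def cyclic_difference_eq_iff)
qed

lemma circ_unit_vec_mult:
  assumes "i < n" "j < n"
  shows "circ (unit_vec n i) * circ (unit_vec n j) = circ (unit_vec n ((i + j) mod n))"
proof (rule eq_matI)
  fix a b
  assume "a < dim_row (circ (unit_vec n ((i + j) mod n)))"
    and "b < dim_col (circ (unit_vec n ((i + j) mod n)))"
  hence ab: "a < n" "b < n" by simp_all
  let ?x = "(a + i) mod n"
  have x: "?x < n" using ab by simp
  have "(circ (unit_vec n i) * circ (unit_vec n j)) $$ (a, b) =
      (\<Sum>x = 0..<n. circ (unit_vec n i) $$ (a, x) * circ (unit_vec n j) $$ (x, b))"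
    using ab by (simp add: scalar_prod_def)
  also have "\<dots> = (\<Sum>x = 0..<n. if x = ?x then of_bool (b = (?x + j) mod n) else 0)"
    using ab assms by (intro sum.cong) (auto simp: circ_unit_vec_index)
  also have "\<dots> = of_bool (b = (?x + j) mod n)" using x by (simp add: sum.delta)
  also have "(?x + j) mod n = (a + (i + j) mod n) mod n" by (simp add: mod_simps add.assoc)
  also have "of_bool (b = \<dots>) = circ (unit_vec n ((i + j) mod n)) $$ (a, b)"
    using ab by (simp add: circ_unit_vec_index)
  finally show "(circ (unit_vec n i) * circ (unit_vec n j)) $$ (a, b) =
      circ (unit_vec n ((i + j) mod n)) $$ (a, b)" .
qed simp_all

lemma shift_mat_pow:
  assumes "n \<ge> 1"
  shows "shift_mat n ^\<^sub>m k = circ (unit_vec n (k mod n))"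
proof (induction k)
  case 0
  show ?case
    using assms
    by (intro eq_matI) (auto simp: shift_mat_def circ_unit_vec_index)
next
  case (Suc k)
  have "shift_mat n ^\<^sub>m Suc k = circ (unit_vec n (k mod n)) * circ (unit_vec n (1 mod n))"
    by (simp add: Suc.IH) (simp add: shift_mat_def)
  also have "\<dots> = circ (unit_vec n ((k mod n + 1 mod n) mod n))"
    using assms by (intro circ_unit_vec_mult) simp_all
  also have "(k mod n + 1 mod n) mod n = Suc k mod n" by (simp only: mod_add_eq Suc_eq_plus1)
  finally show ?case .
qed

lemma smult_circ: "a \<cdot>\<^sub>m circ v = circ (a \<cdot>\<^sub>v v)"
proof (rule eq_matI)
  fix i j
  assume "i < dim_row (circ (a \<cdot>\<^sub>v v))" "j < dim_col (circ (a \<cdot>\<^sub>v v))"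
  moreover from this have "(j + dim_vec v - i) mod dim_vec v < dim_vec v" by simp
  ultimately show "(a \<cdot>\<^sub>m circ v) $$ (i, j) = circ (a \<cdot>\<^sub>v v) $$ (i, j)"
    by (simp add: circ_def)
qed simp_all

section \<open>The block circulant form of the comultiplication\<close>

lemma dim_circulant_comult [simp]:
  "dim_row (circulant_comult n C) = n * n" "dim_col (circulant_comult n C) = n * n"
  by (simp_all add: circulant_comult_def circ_tensor_circ_def)

text \<open>
  The coordinate array of \<open>\<Delta>(\<Sum>\<^sub>i c\<^sub>i e\<^sub>i)\<close> is diagonal, so only the products \<open>P\<^sup>i \<otimes> P\<^sup>i\<close> remain. The
  block position determines the one \<open>i\<close> for which the left factor does not vanish.
\<close>

lemma circulant_comult_index:
  fixes n r s :: nat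
  defines "k \<equiv> (s div n + n - r div n) mod n"
  assumes c: "c \<in> carrier_vec n" and r: "r < n * n" and s: "s < n * n"
  shows "circulant_comult n (circ c) $$ (r, s) =
    c $ k * circ (unit_vec n k) $$ (r mod n, s mod n)"
proof -
  have n: "n > 0" using r by (cases n) auto
  have k: "k < n" using n by (simp add: k_def)
  have rs: "r div n < n" "s div n < n" "r mod n < n" "s mod n < n"
    using r s n by (auto simp: less_mult_imp_div_less)
  let ?K = "\<lambda>i j. circ (unit_vec n i) $$ (r div n, s div n) *
      circ (unit_vec n j) $$ (r mod n, s mod n)"
  have comult: "group_comult n c $$ (i, j) = (if i = j then c $ i else 0)"
    if ij: "i < n" "j < n" for i j
  proof -
    have "group_comult n c $$ (i, j) =
        (\<Sum>l<n. c $ l * (unit_vec n l $ i * unit_vec n l $ j))"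
      using ij by (simp add: group_comult_def tensor_vec_def)
    also have "\<dots> = (\<Sum>l<n. if l = i then (if i = j then c $ i else 0) else 0)"
      using ij by (intro sum.cong) (auto simp: unit_vec_def)
    finally have "group_comult n c $$ (i, j) =
        (\<Sum>l<n. if l = i then (if i = j then c $ i else 0) else 0)" .
    thus ?thesis using ij by (simp add: sum.delta)
  qed
  have "circulant_comult n (circ c) $$ (r, s) =
      (\<Sum>i<n. \<Sum>j<n. group_comult n c $$ (i, j) * ?K i j)"
    using c r s
    by (simp add: circulant_comult_def inv_into_f_f[OF circ_inj_on] circ_tensor_circ_def
        kronecker_def)
  also have "\<dots> = (\<Sum>i<n. \<Sum>j<n. if j = i then c $ i * ?K i i else 0)"
    by (intro sum.cong) (auto simp: comult)
  also have "\<dots> = (\<Sum>i<n. c $ i * ?K i i)" by (simp add: sum.delta)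
  also have "\<dots> = (\<Sum>i<n. if i = k then c $ k * circ (unit_vec n k) $$ (r mod n, s mod n) else 0)"
    using rs k cyclic_difference_eq_iff[OF rs(1,2)]
    by (intro sum.cong) (auto simp: circ_unit_vec_index k_def[symmetric])
  also have "\<dots> = c $ k * circ (unit_vec n k) $$ (r mod n, s mod n)"
    using k by (simp add: sum.delta)
  finally show ?thesis .
qed

lemma circulant_comult_eq_block_circ:
  assumes n: "n \<ge> 1" and c: "c \<in> carrier_vec n"
  shows "circulant_comult n (circ c) = block_circ n (\<lambda>k. c $ k \<cdot>\<^sub>m (shift_mat n ^\<^sub>m k))"
proof (rule eq_matI)
  fix r s
  assume "r < dim_row (block_circ n (\<lambda>k. c $ k \<cdot>\<^sub>m (shift_mat n ^\<^sub>m k)))"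
    and "s < dim_col (block_circ n (\<lambda>k. c $ k \<cdot>\<^sub>m (shift_mat n ^\<^sub>m k)))"
  hence "r < n * n" "s < n * n" by (simp_all add: block_circ_def)
  thus "circulant_comult n (circ c) $$ (r, s) =
      block_circ n (\<lambda>k. c $ k \<cdot>\<^sub>m (shift_mat n ^\<^sub>m k)) $$ (r, s)"
    using n by (simp add: circulant_comult_index[OF c] block_circ_def shift_mat_pow[OF n])
qed (simp_all add: block_circ_def)

section \<open>Characteristic polynomials of permuted and block diagonal matrices\<close>

text \<open>
  Both row and column permutations multiply a determinant by the sign of the permutation, and the
  two signs cancel; the scalar part of \<open>X I - A\<close> is invariant because the permutation is
  injective.
\<close>

lemma char_poly_permute_rows_cols:
  fixes A :: "'a :: comm_ring_1 mat"
  assumes A: "A \<in> carrier_mat N N" and p: "p permutes {0..<N}"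
  shows "char_poly (mat N N (\<lambda>(i, j). A $$ (p i, p j))) = char_poly A"
proof -
  let ?M = "char_poly_matrix A"
  let ?R = "mat N N (\<lambda>(i, j). ?M $$ (p i, j))"
  have M: "?M \<in> carrier_mat N N" using A by simp
  have pN: "p i < N" if "i < N" for i using permutes_in_image[OF p, of i] that by simp
  have inj: "p i = p j \<longleftrightarrow> i = j" for i j using permutes_inj[OF p] by (auto simp: inj_def)
  have "char_poly_matrix (mat N N (\<lambda>(i, j). A $$ (p i, p j))) =
      transpose_mat (mat N N (\<lambda>(i, j). transpose_mat ?R $$ (p i, j)))"
    using A by (intro eq_matI) (auto simp: char_poly_matrix_def pN inj)
  hence "char_poly (mat N N (\<lambda>(i, j). A $$ (p i, p j))) =
      det (mat N N (\<lambda>(i, j). transpose_mat ?R $$ (p i, j)))"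
    by (simp add: char_poly_def det_transpose[of _ N])
  also have "\<dots> = signof p * det ?R"
    using p by (simp add: det_permute_rows[of _ N] det_transpose[of _ N])
  also have "det ?R = signof p * det ?M" by (rule det_permute_rows[OF M p])
  finally show ?thesis by (simp add: char_poly_def sign_def)
qed

lemma char_poly_four_block_lower_left_zero:
  fixes A :: "'a :: idom mat"
  assumes A: "A \<in> carrier_mat n n" and B: "B \<in> carrier_mat n m" and D: "D \<in> carrier_mat m m"
  shows "char_poly (four_block_mat A B (0\<^sub>m m n) D) = char_poly A * char_poly D"
proof -
  have "char_poly_matrix (four_block_mat A B (0\<^sub>m m n) D) =
      four_block_mat (char_poly_matrix A) (map_mat (\<lambda>a. [:- a:]) B) (0\<^sub>m m n) (char_poly_matrix D)"
    using A B D by (intro eq_matI) (auto simp: char_poly_matrix_def)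
  thus ?thesis
    using A B D by (simp add: char_poly_def det_four_block_mat_lower_left_zero[of _ n _ m])
qed

lemma char_poly_kronecker_one:
  fixes A :: "complex mat"
  assumes A: "A \<in> carrier_mat n n"
  shows "char_poly (kronecker (1\<^sub>m m) A) = char_poly A ^ m"
proof (cases "n = 0")
  case True
  hence "kronecker (1\<^sub>m m) A \<in> carrier_mat 0 0" using A by (auto simp: kronecker_def)
  thus ?thesis using A True by (simp add: char_poly_def)
next
  case n: False
  show ?thesis
  proof (induction m)
    case 0
    have "kronecker (1\<^sub>m 0) A \<in> carrier_mat 0 0" by (auto simp: kronecker_def)
    thus ?case by (simp add: char_poly_def)
  next
    case (Suc m)
    let ?K = "kronecker (1\<^sub>m m) A"
    have K: "?K \<in> carrier_mat (m * n) (m * n)" using A by (auto simp: kronecker_def)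
    \<comment> \<open>Split off the first copy of \<open>A\<close>.\<close>
    have split: "kronecker (1\<^sub>m (Suc m)) A = four_block_mat A (0\<^sub>m n (m * n)) (0\<^sub>m (m * n) n) ?K"
    proof (rule eq_matI)
      fix r s
      assume "r < dim_row (four_block_mat A (0\<^sub>m n (m * n)) (0\<^sub>m (m * n) n) ?K)"
        and "s < dim_col (four_block_mat A (0\<^sub>m n (m * n)) (0\<^sub>m (m * n) n) ?K)"
      hence rs: "r < n + m * n" "s < n + m * n" using A K by auto
      have "r div n < Suc m" "s div n < Suc m"
        using rs by (auto intro!: less_mult_imp_div_less)
      moreover have "x div n = Suc ((x - n) div n)" "x mod n = (x - n) mod n"
        if "\<not> x < n" for x
        using that n by (simp_all add: le_div_geq le_mod_geq)
      moreover have "(x - n) div n < m" if "\<not> x < n" "x < n + m * n" for x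
        using that by (intro less_mult_imp_div_less) auto
      ultimately show "kronecker (1\<^sub>m (Suc m)) A $$ (r, s) =
          four_block_mat A (0\<^sub>m n (m * n)) (0\<^sub>m (m * n) n) ?K $$ (r, s)"
        using rs A n by (cases "r < n"; cases "s < n") (auto simp: kronecker_def)
    qed (use A in \<open>auto simp: kronecker_def\<close>)
    show ?case
      unfolding split char_poly_four_block_lower_left_zero[OF A zero_carrier_mat K]
      by (simp add: Suc.IH)
  qed
qed

section \<open>Reindexing the comultiplication along its diagonals\<close>

text \<open>
  The index \<open>d n + a\<close> stands for the pair \<open>(d, a)\<close>, and is sent to the index of the pair
  \<open>(a, a + d)\<close> of residues. Outside the range of indices the map is the identity, as
  \<^const>\<open>permutes\<close> requires.
\<close>

definition diagonal_reindexing :: "nat \<Rightarrow> nat \<Rightarrow> nat" where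
  "diagonal_reindexing n r =
    (if r < n * n then (r mod n) * n + (r mod n + r div n) mod n else r)"

lemma diagonal_reindexing_coordinates:
  assumes "r < n * n"
  shows "diagonal_reindexing n r div n = r mod n"
    and "diagonal_reindexing n r mod n = (r mod n + r div n) mod n"
    and "diagonal_reindexing n r < n * n"
proof -
  have n: "n > 0" using assms by (cases n) auto
  show "diagonal_reindexing n r div n = r mod n"
    and "diagonal_reindexing n r mod n = (r mod n + r div n) mod n"
    using assms n by (simp_all add: diagonal_reindexing_def)
  hence "diagonal_reindexing n r div n < n" using n by simp
  thus "diagonal_reindexing n r < n * n" using n by (simp add: div_less_iff_less_mult)
qed

lemma add_mod_cancel_left:
  fixes a d d' n :: nat
  assumes "d < n" "d' < n"
  shows "(a + d) mod n = (a + d') mod n \<longleftrightarrow> d = d'"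
  using assms cong_add_lcancel_nat[of a d d' n] by (simp add: cong_def)

lemma diagonal_reindexing_permutes: "diagonal_reindexing n permutes {0..<n * n}"
proof (rule bij_imp_permutes)
  have inj: "inj_on (diagonal_reindexing n) {0..<n * n}"
  proof (rule inj_onI)
    fix r s
    assume "r \<in> {0..<n * n}" "s \<in> {0..<n * n}"
      and eq: "diagonal_reindexing n r = diagonal_reindexing n s"
    hence rs: "r < n * n" "s < n * n" by simp_all
    have m: "r mod n = s mod n"
      using eq diagonal_reindexing_coordinates(1)[OF rs(1)]
        diagonal_reindexing_coordinates(1)[OF rs(2)] by simp
    have "(r mod n + r div n) mod n = (r mod n + s div n) mod n"
      using eq m diagonal_reindexing_coordinates(2)[OF rs(1)]
        diagonal_reindexing_coordinates(2)[OF rs(2)] by simp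
    hence "r div n = s div n"
      using rs by (subst (asm) add_mod_cancel_left) (auto simp: less_mult_imp_div_less)
    with m show "r = s" by (metis div_mult_mod_eq)
  qed
  have "diagonal_reindexing n ` {0..<n * n} \<subseteq> {0..<n * n}"
    using diagonal_reindexing_coordinates(3) by auto
  with inj show "bij_betw (diagonal_reindexing n) {0..<n * n} {0..<n * n}"
    by (simp add: bij_betw_def endo_inj_surj)
qed (simp add: diagonal_reindexing_def)

text \<open>
  The entry of \<open>\<Delta>(C)\<close> at \<open>((a, a + d), (a', a' + d'))\<close> carries the coefficient \<open>C\<^sub>a\<^sub>,\<^sub>a\<^sub>'\<close> and the condition
  \<open>a' + d' \<equiv> (a + d) + (a' - a)\<close> modulo \<open>n\<close>, which says \<open>d = d'\<close>.
\<close>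

lemma circulant_comult_reindexed:
  assumes c: "c \<in> carrier_vec n"
  shows "mat (n * n) (n * n) (\<lambda>(r, s). circulant_comult n (circ c) $$
      (diagonal_reindexing n r, diagonal_reindexing n s)) = kronecker (1\<^sub>m n) (circ c)"
    (is "?L = ?R")
proof (rule eq_matI)
  fix r s
  assume "r < dim_row ?R" "s < dim_col ?R"
  hence r: "r < n * n" and s: "s < n * n" using c by (simp_all add: kronecker_def)
  hence n: "n > 0" by (cases n) auto
  have rs: "r div n < n" "s div n < n" "r mod n < n" "s mod n < n"
    using r s n by (auto simp: less_mult_imp_div_less)
  \<comment> \<open>The residue of \<open>a' - a\<close>, where \<open>r = (d, a)\<close> and \<open>s = (d', a')\<close>.\<close>
  define k where "k = (s mod n + n - r mod n) mod n"
  have k: "k < n" using n by (simp add: k_def)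
  have shift: "(r mod n + k) mod n = s mod n"
    using cyclic_difference_eq_iff[OF rs(3,4) k] by (simp add: k_def)
  have "((r mod n + r div n) mod n + k) mod n = ((r mod n + k) mod n + r div n) mod n"
    by (simp only: mod_add_left_eq) (simp add: ac_simps)
  also have "\<dots> = (s mod n + r div n) mod n" by (simp only: shift)
  finally have "(s mod n + s div n) mod n = ((r mod n + r div n) mod n + k) mod n
      \<longleftrightarrow> r div n = s div n"
    using add_mod_cancel_left[OF rs(2,1)] by auto
  hence "?L $$ (r, s) = c $ k * of_bool (r div n = s div n)"
    using r s n k
    by (simp add: circulant_comult_index[OF c] diagonal_reindexing_coordinates
        circ_unit_vec_index flip: k_def)
  also have "\<dots> = ?R $$ (r, s)"
    using r s c rs by (auto simp: kronecker_def circ_def k_def)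
  finally show "?L $$ (r, s) = ?R $$ (r, s)" .
qed (use c in \<open>simp_all add: kronecker_def\<close>)

lemma char_poly_circulant_comult:
  assumes c: "c \<in> carrier_vec n"
  shows "char_poly (circulant_comult n (circ c)) = char_poly (circ c) ^ n"
proof -
  have "circulant_comult n (circ c) \<in> carrier_mat (n * n) (n * n)" by (simp add: carrier_matI)
  from char_poly_permute_rows_cols[OF this diagonal_reindexing_permutes]
  have "char_poly (circulant_comult n (circ c)) = char_poly (kronecker (1\<^sub>m n) (circ c))"
    by (simp add: circulant_comult_reindexed[OF c])
  also have "\<dots> = char_poly (circ c) ^ n"
    using c by (intro char_poly_kronecker_one carrier_matI) simp_all
  finally show ?thesis .
qed

theorem theorem4p1:
  fixes n :: nat and c :: "complex vec"
  assumes "n \<ge> 1" and "c \<in> carrier_vec n"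
  shows "circulant_comult n (circ c) = block_circ n (\<lambda>k. c $ k \<cdot>\<^sub>m (shift_mat n ^\<^sub>m k))
    \<and> (\<forall>k<n. c $ k \<cdot>\<^sub>m (shift_mat n ^\<^sub>m k) \<in> circulants n)
    \<and> eigenvalue_mset (circulant_comult n (circ c)) = repeat_mset n (eigenvalue_mset (circ c))"
proof (intro conjI allI impI)
  show "circulant_comult n (circ c) = block_circ n (\<lambda>k. c $ k \<cdot>\<^sub>m (shift_mat n ^\<^sub>m k))"
    using assms by (rule circulant_comult_eq_block_circ)
  show "c $ k \<cdot>\<^sub>m (shift_mat n ^\<^sub>m k) \<in> circulants n" for k
    unfolding shift_mat_pow[OF assms(1)] smult_circ circulants_def by (intro imageI) simp
  show "eigenvalue_mset (circulant_comult n (circ c)) =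
      repeat_mset n (eigenvalue_mset (circ c))"
    by (simp add: eigenvalue_mset_def char_poly_circulant_comult[OF assms(2)] proots_power)
qed

end
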